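(* For every integer $n>0$, let $b=\lfloor \log_2 n\rfloor$ and $c=n+1-2^{b}$. Then $a_3(n)=2^{2b}+3c^2$.
   Context: A P-position of the game of Nim with $k$ piles is a $k$-tuple $(p_1,\dots,p_k)$ of non-negative integers whose nim-sum $p_1\oplus\cdots\oplus p_k$ is $0$, where $\oplus$ denotes bitwise XOR. $a_k(n)$ denotes the number of P-positions with $k$ piles such that every pile has at most $n$ counters (i.e. $\max_i p_i\le n$). *)

theory Defs
  imports Complex_Main
begin

unbundle bit_operations_syntax

definition nim_sum :: "nat list \<Rightarrow> nat" where
  "nim_sum ps = foldr (XOR) ps 0"

definition P_positions :: "nat \<Rightarrow> nat list set" where
  "P_positions k = {ps. length ps = k \<and> nim_sum ps = 0}"

definition a :: "nat \<Rightarrow> nat \<Rightarrow> nat" where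
  "a k n = card {ps \<in> P_positions k. \<forall>p \<in> set ps. p \<le> n}"

text \<open>The set counted by \<^const>\<open>a\<close> is finite, so \<^const>\<open>card\<close> gives its actual size.\<close>

lemma finite_bounded_P_positions: "finite {ps \<in> P_positions k. \<forall>p \<in> set ps. p \<le> n}"
  by (rule finite_subset[OF _ finite_lists_length_eq[of "{..n}" k]])
    (auto simp: P_positions_def)

end

(* Put N = 2^b, so that all piles are below 2N and the nim-sum being 0 forces an even number of
   the three piles to be at least N. If no pile is, the first two are free in {0..<N}, which gives
   N^2 positions. If exactly two are, these two are free in {N..n}, a set with c elements, and the
   third, their nim-sum, is automatically below N; this gives c^2 positions for each of the three
   places of the small pile. *)
theory Submission
  imports Defs
begin

lemma xor_cancel:
  fixes x y :: nat
  shows "x XOR (x XOR y) = y" "(x XOR y) XOR x = y" "y XOR (x XOR y) = x" "(x XOR y) XOR y = x"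
proof -
  show "x XOR (x XOR y) = y" "(x XOR y) XOR y = x"
    by (simp add: xor.assoc [symmetric], simp add: xor.assoc)
  then show "(x XOR y) XOR x = y" "y XOR (x XOR y) = x"
    by (simp_all only: xor.commute)
qed

lemma nim_sum_3_eq_0_iff: "nim_sum [x, y, z] = 0 \<longleftrightarrow> z = x XOR y"
proof
  assume "nim_sum [x, y, z] = 0"
  then have "(x XOR y) XOR z = 0"
    by (simp add: nim_sum_def xor.assoc)
  then show "z = x XOR y"
    using xor_cancel(4) [of "x XOR y" z] by simp
qed (simp add: nim_sum_def xor_cancel)

text \<open>Division by \<open>2 ^ m\<close> drops the low \<open>m\<close> bits, and XOR acts on
  each bit separately.\<close>

lemma xor_div_power_2: "(x XOR y) div 2 ^ m = (x div 2 ^ m) XOR (y div 2 ^ m)"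
  for x y :: nat
  by (simp add: drop_bit_xor flip: drop_bit_eq_div)

lemma div_eq_1_iff: "x div m = 1 \<longleftrightarrow> m \<le> x \<and> x < 2 * m" if "m > 0" for x m :: nat
proof
  assume "x div m = 1"
  then show "m \<le> x \<and> x < 2 * m"
    using that div_times_less_eq_dividend [of x m] dividend_less_div_times [of m x] by simp
qed (auto intro: div_nat_eqI)

text \<open>Both quotients by \<open>2 ^ m\<close> are 0 or both are 1, so they cancel under XOR and
  only bits below position \<open>m\<close> can survive.\<close>

lemma xor_less_power_2: "x XOR y < 2 ^ m"
  if "x < 2 ^ m \<and> y < 2 ^ m \<or> 2 ^ m \<le> x \<and> x < 2 * 2 ^ m \<and> 2 ^ m \<le> y \<and> y < 2 * 2 ^ m"
  for x y :: nat
proof -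
  have "x div 2 ^ m = y div 2 ^ m"
    using that div_eq_1_iff [of "2 ^ m" x] div_eq_1_iff [of "2 ^ m" y] by (elim disjE) simp_all
  then have "(x XOR y) div 2 ^ m = 0"
    by (simp add: xor_div_power_2)
  then show ?thesis
    by (simp add: div_eq_0_iff)
qed

text \<open>The quotients by \<open>2 ^ m\<close> are 0 and 1, so bit \<open>m\<close> survives in
  the XOR.\<close>

lemma power_2_le_xor: "2 ^ m \<le> x XOR y"
  if "x < 2 ^ m" "2 ^ m \<le> y" "y < 2 * 2 ^ m" for x y :: nat
proof -
  have "y div 2 ^ m = 1"
    using that div_eq_1_iff [of "2 ^ m" y] by simp
  then have "(x XOR y) div 2 ^ m = 1"
    using that by (simp add: xor_div_power_2)
  then show ?thesis
    using div_eq_1_iff [of "2 ^ m" "x XOR y"] by simp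
qed

text \<open>The first image has no large pile; in the other three the small pile stands third,
  second and first, and is computed from the two large ones.\<close>

lemma bounded_P_positions_3_eq:
  fixes n m :: nat
  assumes "2 ^ m \<le> n" "n < 2 * 2 ^ m"
  defines "A \<equiv> {..<2 ^ m :: nat}" and "B \<equiv> {2 ^ m..n}"
  shows "{ps \<in> P_positions 3. \<forall>p \<in> set ps. p \<le> n} =
    (\<lambda>(x, y). [x, y, x XOR y]) ` (A \<times> A) \<union> (\<lambda>(x, y). [x, y, x XOR y]) ` (B \<times> B) \<union>
    (\<lambda>(x, y). [x, x XOR y, y]) ` (B \<times> B) \<union> (\<lambda>(x, y). [x XOR y, x, y]) ` (B \<times> B)"
    (is "?P = ?R")
proof (intro equalityI subsetI)
  fix ps assume "ps \<in> ?P"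
  then obtain x y where ps: "ps = [x, y, x XOR y]" and le: "x \<le> n" "y \<le> n" "x XOR y \<le> n"
    by (auto simp: P_positions_def numeral_3_eq_3 length_Suc_conv nim_sum_3_eq_0_iff)
  consider "x \<in> A" "y \<in> A" | "x \<in> B" "y \<in> B" | "x \<in> B" "y \<in> A" | "x \<in> A" "y \<in> B"
    using le unfolding A_def B_def by force
  then show "ps \<in> ?R"
  proof cases
    case 3
    then have "x XOR y \<in> B"
      using power_2_le_xor [of y m x] le assms by (simp add: A_def B_def xor.commute)
    \<comment> \<open>The parameters are the two large entries \<open>x\<close> and
      \<open>x XOR y\<close>; their XOR gives back the small entry \<open>y\<close>.\<close>
    with 3 have "ps \<in> (\<lambda>(x, y). [x, x XOR y, y]) ` (B \<times> B)"
      unfolding ps by (intro image_eqI [where x = "(x, x XOR y)"]) (auto simp: xor_cancel)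
    then show ?thesis by blast
  next
    case 4
    then have "x XOR y \<in> B"
      using power_2_le_xor [of x m y] le assms by (simp add: A_def B_def)
    with 4 have "ps \<in> (\<lambda>(x, y). [x XOR y, x, y]) ` (B \<times> B)"
      unfolding ps by (intro image_eqI [where x = "(y, x XOR y)"]) (auto simp: xor_cancel)
    then show ?thesis by blast
  qed (auto simp: ps)
next
  fix ps assume "ps \<in> ?R"
  \<comment> \<open>In both cases the XOR is below \<open>2 ^ m\<close>, hence below
    \<open>n\<close>.\<close>
  moreover have "x XOR y \<le> n" if "x \<in> A \<and> y \<in> A \<or> x \<in> B \<and> y \<in> B" for x y
    using xor_less_power_2 [of x m y] that assms by (auto simp: A_def B_def)
  moreover have "x \<le> n" if "x \<in> A \<or> x \<in> B" for x
    using that assms by (auto simp: A_def B_def)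
  ultimately show "ps \<in> ?P"
    by (auto simp: P_positions_def nim_sum_3_eq_0_iff xor_cancel)
qed

lemma a_3_eq:
  assumes "2 ^ m \<le> n" "n < 2 * 2 ^ m"
  shows "a 3 n = (2 ^ m)\<^sup>2 + 3 * (Suc n - 2 ^ m)\<^sup>2"
proof -
  define A B where "A = {..<2 ^ m :: nat}" and "B = {2 ^ m..n}"
  define S0 where "S0 = (\<lambda>(x, y). [x, y, x XOR y]) ` (A \<times> A)"
  define S1 where "S1 = (\<lambda>(x, y). [x, y, x XOR y]) ` (B \<times> B)"
  define S2 where "S2 = (\<lambda>(x, y). [x, x XOR y, y]) ` (B \<times> B)"
  define S3 where "S3 = (\<lambda>(x, y). [x XOR y, x, y]) ` (B \<times> B)"
  note S_defs = S0_def S1_def S2_def S3_def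
  have AB: "x \<in> A \<Longrightarrow> x \<in> B \<Longrightarrow> False" for x
    by (simp add: A_def B_def)
  have xor_A: "x XOR y \<in> A" if "x \<in> B" "y \<in> B" for x y
    using xor_less_power_2 [of x m y] that assms by (simp add: A_def B_def)
  have fin: "finite S0" "finite S1" "finite S2" "finite S3"
    by (simp_all add: S_defs A_def B_def)
  \<comment> \<open>Any two of the four families differ at some place where one has an entry from
    \<open>A\<close> and the other an entry from \<open>B\<close>.\<close>
  have disjoint: "S0 \<inter> S1 = {}" "(S0 \<union> S1) \<inter> S2 = {}" "(S0 \<union> S1 \<union> S2) \<inter> S3 = {}"
    using AB xor_A unfolding S_defs by fastforce+
  \<comment> \<open>Each parametrization is injective because both parameters occur as entries of
    the list.\<close>
  have "card S0 = (2 ^ m)\<^sup>2"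
    unfolding S0_def by (subst card_image) (auto simp: inj_on_def A_def power2_eq_square)
  moreover have "card S1 = (Suc n - 2 ^ m)\<^sup>2" "card S2 = (Suc n - 2 ^ m)\<^sup>2"
    "card S3 = (Suc n - 2 ^ m)\<^sup>2"
    unfolding S_defs
    by (subst card_image; auto simp: inj_on_def B_def power2_eq_square)+
  moreover have "a 3 n = card (S0 \<union> S1 \<union> S2 \<union> S3)"
    unfolding a_def bounded_P_positions_3_eq [OF assms] S_defs A_def B_def ..
  ultimately show ?thesis
    using fin disjoint by (simp add: card_Un_disjoint)
qed

theorem theorem12:
  fixes n b :: nat and c :: int
  assumes "n > 0"
    and "b = nat \<lfloor>log 2 (real n)\<rfloor>"
    and "c = int n + 1 - 2 ^ b"
  shows "int (a 3 n) = 2 ^ (2 * b) + 3 * c\<^sup>2"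
proof -
  \<comment> \<open>Since \<open>n\<close> is at least 1, the logarithm is nonnegative and
    \<open>nat\<close> does not truncate.\<close>
  have "\<lfloor>log 2 (real n)\<rfloor> = int b"
    using assms(1,2) by (simp add: zero_le_log_cancel_iff)
  then have bounds: "2 ^ b \<le> n" "n < 2 * 2 ^ b"
    using floor_log_nat_eq_powr_iff [of 2 n b] assms(1) by simp_all
  \<comment> \<open>The lower bound on \<open>n\<close> keeps the subtraction on naturals from
    truncating.\<close>
  then have "c = int (Suc n - 2 ^ b)"
    using assms(3) by (simp add: of_nat_diff)
  then show ?thesis
    using a_3_eq [OF bounds] by (simp add: mult.commute flip: power_mult)
qed

end
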